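(* Let $\{l_{\mathrm R}(i)\in\{0,1\}\}_{i\in\mathbb{N}_0}$ be a time-inhomogeneous Markov chain with transition probabilities $p_{q,r}(i)$, and let $p_1,p_0\in(0,1)$ satisfy $p_{q,1}(i)\le p_1$ and $p_{q,0}(i)\le p_0$ for all $q\in\{0,1\}$, $i\in\mathbb{N}_0$. Let $\{l_{\mathrm M}(i)\in\{0,1\}\}_{i\in\mathbb{N}_0}$ be a binary-valued process for which there is a scalar $\rho_{\mathrm M}\in[0,1]$ with $$\sum_{k=1}^{\infty}\mathbb{P}\Big[\sum_{i=0}^{k-1}l_{\mathrm M}(i)>\rho_{\mathrm M}k\Big]<\infty .$$ Assume that $\{l_{\mathrm R}(i)\}_{i\in\mathbb{N}_0}$ and $\{l_{\mathrm M}(i)\}_{i\in\mathbb{N}_0}$ are mutually independent. Define $l(i)=1$ if $l_{\mathrm R}(i)=1$ or $l_{\mathrm M}(i)=1$, and $l(i)=0$ otherwise, and let $L(k)\triangleq\sum_{i=0}^{k-1}l(i)$, $k\in\mathbb{N}$. If $$p_1+p_0\rho_{\mathrm M}<1,$$ then $$\sum_{k=1}^{\infty}\mathbb{P}[L(k)>\rho k]<\infty\quad\text{for all }\rho\in(p_1+p_0\rho_{\mathrm M},1).$$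
   Context: $\mathbb{N}$ and $\mathbb{N}_0$ denote the positive and nonnegative integers. The time-inhomogeneous Markov chain $\{l_{\mathrm R}(i)\}$ has an arbitrary initial distribution on $\{0,1\}$ and transition probabilities $p_{q,r}:\mathbb{N}_0\to[0,1]$, $\mathbb{P}[l_{\mathrm R}(i+1)=r\mid l_{\mathrm R}(i)=q]=p_{q,r}(i)$, $q,r\in\{0,1\}$. (Here $l_{\mathrm R}$ models random packet losses, $l_{\mathrm M}$ malicious attacks, and $l$ overall packet exchange failures.) *)

theory Defs
  imports "HOL-Probability.Probability"
begin

definition binary_process :: "'a measure \<Rightarrow> (nat \<Rightarrow> 'a \<Rightarrow> nat) \<Rightarrow> bool" where
  "binary_process M X \<longleftrightarrow> (\<forall>i. X i \<in> measurable M (count_space {0, 1}))"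

text \<open>
  Time-inhomogeneous Markov chain on the states 0 and 1, with \<open>p q r i\<close> the probability of
  moving from \<open>q\<close> at time \<open>i\<close> to \<open>r\<close> at time \<open>i + 1\<close>; the initial distribution is arbitrary.
  Since \<^const>\<open>cond_prob\<close> is 0 when the conditioning event has probability 0, conditional
  probabilities are only compared for conditioning events of positive probability. That
  \<open>p q 0 i + p q 1 i = 1\<close> is thereby implied for every state \<open>q\<close> that is reached at time \<open>i\<close>
  with positive probability; nothing beyond membership in [0, 1] is required of the rows of
  the other states, which do not influence the law of the chain.
\<close>

definition binary_markov_chain ::
  "'a measure \<Rightarrow> (nat \<Rightarrow> nat \<Rightarrow> nat \<Rightarrow> real) \<Rightarrow> (nat \<Rightarrow> 'a \<Rightarrow> nat) \<Rightarrow> bool" where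
  "binary_markov_chain M p X \<longleftrightarrow>
     binary_process M X \<and>
     (\<forall>q\<in>{0, 1}. \<forall>r\<in>{0, 1}. \<forall>i. p q r i \<in> {0..1}) \<and>
     (\<forall>i. \<forall>s \<in> {..i} \<rightarrow> {0, 1}. \<forall>r\<in>{0, 1}.
        \<P>(\<omega> in M. \<forall>j\<le>i. X j \<omega> = s j) > 0 \<longrightarrow>
        \<P>(\<omega> in M. X (i + 1) \<omega> = r \<bar> \<forall>j\<le>i. X j \<omega> = s j) =
        \<P>(\<omega> in M. X (i + 1) \<omega> = r \<bar> X i \<omega> = s i)) \<and>
     (\<forall>i. \<forall>q\<in>{0, 1}. \<forall>r\<in>{0, 1}.
        \<P>(\<omega> in M. X i \<omega> = q) > 0 \<longrightarrow>
        \<P>(\<omega> in M. X (i + 1) \<omega> = r \<bar> X i \<omega> = q) = p q r i)"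

text \<open>Independence of the two processes as wholes, i.e. as random sequences.\<close>

definition indep_binary_processes ::
  "'a measure \<Rightarrow> (nat \<Rightarrow> 'a \<Rightarrow> nat) \<Rightarrow> (nat \<Rightarrow> 'a \<Rightarrow> nat) \<Rightarrow> bool" where
  "indep_binary_processes M X Y \<longleftrightarrow>
     prob_space.indep_var M
       (\<Pi>\<^sub>M i\<in>UNIV. count_space {0, 1}) (\<lambda>\<omega> i. X i \<omega>)
       (\<Pi>\<^sub>M i\<in>UNIV. count_space {0, 1}) (\<lambda>\<omega> i. Y i \<omega>)"

definition exchange_failure ::
  "(nat \<Rightarrow> 'a \<Rightarrow> nat) \<Rightarrow> (nat \<Rightarrow> 'a \<Rightarrow> nat) \<Rightarrow> nat \<Rightarrow> 'a \<Rightarrow> nat" where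
  "exchange_failure lR lM i \<omega> = (if lR i \<omega> = 1 \<or> lM i \<omega> = 1 then 1 else 0)"

definition total_failures :: "(nat \<Rightarrow> 'a \<Rightarrow> nat) \<Rightarrow> nat \<Rightarrow> 'a \<Rightarrow> nat" where
  "total_failures l k \<omega> = (\<Sum>i<k. l i \<omega>)"

end

theory Submission
  imports Defs
begin

text \<open>
  Since \<open>l = 1\<^bsub>lR=1\<^esub> + lM 1\<^bsub>lR=0\<^esub>\<close>, split \<open>\<rho> = b1 + b0\<close> with \<open>b1 > p1\<close> and \<open>b0 > p0 \<rho>M\<close>: if
  \<open>L k > \<rho> k\<close>, then lR equals 1 more than \<open>b1 k\<close> times, or lM and lR equal 1 and 0
  simultaneously more than \<open>b0 k\<close> times. The transition bounds give, one step at a time,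
  an exponential moment bound for the number of visits of the chain to a state along a
  deterministic set of at most \<open>a k\<close> times, and a Chernoff estimate makes both probabilities
  geometrically small, the second one off the event that lM has more than \<open>\<rho>M k\<close> ones,
  whose probabilities are summable by assumption.
\<close>

section \<open>Transition bounds and exponential moments of the chain\<close>

lemma binary_process_measurable:
  assumes "binary_process M X"
  shows "X i \<in> measurable M (count_space UNIV)"
  using assms measurable_compose[of "X i" M "count_space {0,1}" "\<lambda>x. x" "count_space UNIV"]
  by (auto simp: binary_process_def)

lemma binary_process_values:
  assumes "binary_process M X" "\<omega> \<in> space M"
  shows "X i \<omega> = 0 \<or> X i \<omega> = 1"
  using assms measurable_space[of "X i" M "count_space {0,1}" \<omega>]
  by (auto simp: binary_process_def)

text \<open>The Markov property reduces the full history to its last state \<open>s i\<close>, where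
  the transition bound applies. In terms of joint probabilities the estimate also covers histories
  of probability 0 and can be summed over histories.\<close>

lemma markov_chain_step_bound:
  assumes "prob_space M" and mc: "binary_markov_chain M p X"
    and r: "r \<in> {0, 1}" and le: "\<And>q. q \<in> {0, 1} \<Longrightarrow> p q r i \<le> c" and c: "0 \<le> c"
    and s: "s \<in> {..i} \<rightarrow> {0, 1}"
  shows "\<P>(\<omega> in M. X (Suc i) \<omega> = r \<and> (\<forall>j\<le>i. X j \<omega> = s j))
    \<le> c * \<P>(\<omega> in M. \<forall>j\<le>i. X j \<omega> = s j)"
proof -
  interpret prob_space M by fact
  have [measurable]: "X j \<in> measurable M (count_space UNIV)" for j
    using mc binary_process_measurable by (auto simp: binary_markov_chain_def)
  let ?H = "\<P>(\<omega> in M. \<forall>j\<le>i. X j \<omega> = s j)"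
  have le_H: "\<P>(\<omega> in M. X (Suc i) \<omega> = r \<and> (\<forall>j\<le>i. X j \<omega> = s j)) \<le> ?H"
    by (rule finite_measure_mono) auto
  show ?thesis
  proof (cases "?H > 0")
    case False
    then have "?H = 0" by (simp add: zero_less_measure_iff)
    then show ?thesis using le_H by simp
  next
    case True
    \<comment> \<open>The transition clause speaks only of states reached with positive probability;
      \<open>s i\<close> inherits this from the history.\<close>
    have "?H \<le> \<P>(\<omega> in M. X i \<omega> = s i)"
      by (rule finite_measure_mono) auto
    with True have pos: "\<P>(\<omega> in M. X i \<omega> = s i) > 0" by linarith
    have si: "s i \<in> {0, 1}" using s by auto
    have "\<P>(\<omega> in M. X (i + 1) \<omega> = r \<bar> \<forall>j\<le>i. X j \<omega> = s j)
        = \<P>(\<omega> in M. X (i + 1) \<omega> = r \<bar> X i \<omega> = s i)"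
      using mc s r True unfolding binary_markov_chain_def by blast
    also have "\<dots> = p (s i) r i"
      using mc si r pos unfolding binary_markov_chain_def by blast
    also have "\<dots> \<le> c" by (rule le[OF si])
    finally show ?thesis
      using True by (simp add: cond_prob_def divide_le_eq)
  qed
qed

text \<open>There are finitely many histories up to time \<open>i\<close>, so a function of the
  history is a finite combination of their indicators. Its coefficients \<open>F s\<close> are
  nonnegative, so the one-step bounds can be summed.\<close>

lemma markov_chain_history_expectation:
  fixes F :: "(nat \<Rightarrow> nat) \<Rightarrow> real"
  assumes "prob_space M" and mc: "binary_markov_chain M p X"
    and r: "r \<in> {0, 1}" and le: "\<And>q. q \<in> {0, 1} \<Longrightarrow> p q r i \<le> c" and c: "0 \<le> c"
    and F: "\<And>s. 0 \<le> F s"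
  shows "(LINT \<omega>|M. F (\<lambda>j\<in>{..i}. X j \<omega>) * of_bool (X (Suc i) \<omega> = r))
    \<le> c * (LINT \<omega>|M. F (\<lambda>j\<in>{..i}. X j \<omega>))"
proof -
  interpret prob_space M by fact
  have bp: "binary_process M X"
    using mc by (auto simp: binary_markov_chain_def)
  note [measurable] = binary_process_measurable[OF bp]
  let ?S = "PiE {..i} (\<lambda>_. {0, 1::nat})"
  have fin: "finite ?S" by (intro finite_PiE) auto
  have repr: "F (\<lambda>j\<in>{..i}. X j \<omega>) =
      (\<Sum>s\<in>?S. F s * indicator {\<omega>\<in>space M. \<forall>j\<le>i. X j \<omega> = s j} \<omega>)"
    if "\<omega> \<in> space M" for \<omega>
  proof -
    have mem: "(\<lambda>j\<in>{..i}. X j \<omega>) \<in> ?S"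
      using binary_process_values[OF bp that] by auto
    \<comment> \<open>Members of \<open>?S\<close> are extensional, so agreement on
      \<open>{..i}\<close> is equality and exactly one term of the sum survives.\<close>
    have "(\<forall>j\<le>i. X j \<omega> = s j) \<longleftrightarrow> s = (\<lambda>j\<in>{..i}. X j \<omega>)" if "s \<in> ?S" for s
      using that by (auto simp: PiE_iff extensional_def fun_eq_iff)
    then have "(\<Sum>s\<in>?S. F s * indicator {\<omega>\<in>space M. \<forall>j\<le>i. X j \<omega> = s j} \<omega>)
        = (\<Sum>s\<in>?S. if s = (\<lambda>j\<in>{..i}. X j \<omega>) then F s else 0)"
      using that by (intro sum.cong) (auto simp: indicator_def)
    also have "\<dots> = F (\<lambda>j\<in>{..i}. X j \<omega>)"
      using fin mem by simp
    finally show ?thesis by simp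
  qed
  have "(LINT \<omega>|M. F (\<lambda>j\<in>{..i}. X j \<omega>) * of_bool (X (Suc i) \<omega> = r))
      = (LINT \<omega>|M. (\<Sum>s\<in>?S. F s *
          indicator {\<omega>\<in>space M. X (Suc i) \<omega> = r \<and> (\<forall>j\<le>i. X j \<omega> = s j)} \<omega>))"
    by (intro Bochner_Integration.integral_cong refl)
      (auto simp: repr sum_distrib_right indicator_def intro!: sum.cong)
  also have "\<dots> = (\<Sum>s\<in>?S. F s * \<P>(\<omega> in M. X (Suc i) \<omega> = r \<and> (\<forall>j\<le>i. X j \<omega> = s j)))"
    by (subst Bochner_Integration.integral_sum) (auto simp: less_top[symmetric])
  also have "\<dots> \<le> (\<Sum>s\<in>?S. F s * (c * \<P>(\<omega> in M. \<forall>j\<le>i. X j \<omega> = s j)))"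
    by (intro sum_mono mult_left_mono F markov_chain_step_bound[OF assms(1) mc r le c])
      (simp_all add: PiE_def)
  also have "\<dots> = c * (LINT \<omega>|M. (\<Sum>s\<in>?S. F s *
      indicator {\<omega>\<in>space M. \<forall>j\<le>i. X j \<omega> = s j} \<omega>))"
    by (subst Bochner_Integration.integral_sum)
      (auto simp: less_top[symmetric] sum_distrib_left mult_ac)
  also have "\<dots> = c * (LINT \<omega>|M. F (\<lambda>j\<in>{..i}. X j \<omega>))"
    by (intro arg_cong[where f = "\<lambda>x. c * x"] Bochner_Integration.integral_cong refl)
      (simp add: repr)
  finally show ?thesis .
qed

text \<open>The factor \<open>exp t\<close> pays for time 0, where the distribution is arbitrary.\<close>

lemma markov_chain_mgf_bound:
  fixes w :: "nat \<Rightarrow> nat"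
  assumes "prob_space M" and mc: "binary_markov_chain M p X"
    and r: "r \<in> {0, 1}" and le: "\<And>q i. q \<in> {0, 1} \<Longrightarrow> p q r i \<le> c" and c: "0 \<le> c"
    and w: "\<And>j. j \<le> n \<Longrightarrow> w j \<in> {0, 1}" and t: "0 \<le> t"
  shows "(LINT \<omega>|M. exp (t * (\<Sum>j\<le>n. real (w j) * of_bool (X j \<omega> = r))))
    \<le> exp t * exp (c * (exp t - 1) * (\<Sum>j\<le>n. real (w j)))"
  using w
proof (induction n)
  case 0
  interpret prob_space M by fact
  have bp: "binary_process M X"
    using mc by (auto simp: binary_markov_chain_def)
  note [measurable] = binary_process_measurable[OF bp]
  have bound: "exp (t * (\<Sum>j\<le>0. real (w j) * of_bool (X j \<omega> = r))) \<le> exp t" for \<omega>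
    using 0[of 0] t by (cases "X 0 \<omega> = r") (auto simp del: sum_mult_of_bool_eq)
  have "(LINT \<omega>|M. exp (t * (\<Sum>j\<le>0. real (w j) * of_bool (X j \<omega> = r)))) \<le> exp t"
  proof (rule integral_le_const)
    show "integrable M (\<lambda>\<omega>. exp (t * (\<Sum>j\<le>0. real (w j) * of_bool (X j \<omega> = r))))"
    proof (rule integrable_const_bound[where B = "exp t"])
      show "AE \<omega> in M. norm (exp (t * (\<Sum>j\<le>0. real (w j) * of_bool (X j \<omega> = r)))) \<le> exp t"
        using bound by simp
    qed measurable
  qed (use bound in simp)
  also have "\<dots> \<le> exp t * exp (c * (exp t - 1) * (\<Sum>j\<le>0. real (w j)))"
    using c t by (simp add: mult_le_cancel_left1)
  finally show ?case .
next
  case (Suc n)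
  interpret prob_space M by fact
  have bp: "binary_process M X"
    using mc by (auto simp: binary_markov_chain_def)
  note [measurable] = binary_process_measurable[OF bp]
  define Z where "Z \<omega> = exp (t * (\<Sum>j\<le>n. real (w j) * of_bool (X j \<omega> = r)))" for \<omega>
  define F where "F s = exp (t * (\<Sum>j\<le>n. real (w j) * of_bool (s j = r)))" for s
  have FZ: "F (\<lambda>j\<in>{..n}. X j \<omega>) = Z \<omega>" for \<omega>
    by (simp add: F_def Z_def)
  have wS: "w (Suc n) \<in> {0, 1}" using Suc.prems by blast
  \<comment> \<open>Since \<open>w (Suc n)\<close> is 0 or 1, the new exponential factor equals
    \<open>1 + v * of_bool (X (Suc n) \<omega> = r)\<close>. It is linear in the indicator, so the
    history estimate applies to its expectation.\<close>
  define v where "v = real (w (Suc n)) * (exp t - 1)"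
  have v: "0 \<le> v" using t by (simp add: v_def)
  have Zm [measurable]: "Z \<in> borel_measurable M" unfolding Z_def by measurable
  have intZ: "integrable M Z"
  proof (rule integrable_const_bound[where B = "exp (t * (\<Sum>j\<le>n. real (w j)))"])
    show "AE \<omega> in M. norm (Z \<omega>) \<le> exp (t * (\<Sum>j\<le>n. real (w j)))"
      using t unfolding Z_def
      by (intro AE_I2) (simp del: sum_mult_of_bool_eq, intro mult_left_mono sum_mono, auto)
  qed measurable
  have intZ': "integrable M (\<lambda>\<omega>. Z \<omega> * of_bool (X (Suc n) \<omega> = r))"
  proof (rule Bochner_Integration.integrable_bound[OF intZ])
    show "AE \<omega> in M. norm (Z \<omega> * of_bool (X (Suc n) \<omega> = r)) \<le> norm (Z \<omega>)"
      by simp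
  qed measurable
  have step: "exp (t * (\<Sum>j\<le>Suc n. real (w j) * of_bool (X j \<omega> = r)))
      = Z \<omega> + v * (Z \<omega> * of_bool (X (Suc n) \<omega> = r))" for \<omega>
    using wS by (auto simp: Z_def v_def distrib_left exp_add algebra_simps)
  have "(LINT \<omega>|M. exp (t * (\<Sum>j\<le>Suc n. real (w j) * of_bool (X j \<omega> = r))))
      = (LINT \<omega>|M. Z \<omega>) + v * (LINT \<omega>|M. Z \<omega> * of_bool (X (Suc n) \<omega> = r))"
    unfolding step using intZ intZ' by simp
  also have "(LINT \<omega>|M. Z \<omega> * of_bool (X (Suc n) \<omega> = r)) \<le> c * (LINT \<omega>|M. Z \<omega>)"
    using markov_chain_history_expectation[OF assms(1) mc r le c, where F = F and i = n]
    by (simp add: FZ) (simp add: F_def)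
  then have "(LINT \<omega>|M. Z \<omega>) + v * (LINT \<omega>|M. Z \<omega> * of_bool (X (Suc n) \<omega> = r))
      \<le> (LINT \<omega>|M. Z \<omega>) + v * (c * (LINT \<omega>|M. Z \<omega>))"
    using v by (intro add_left_mono mult_left_mono)
  also have "\<dots> = (1 + c * v) * (LINT \<omega>|M. Z \<omega>)" by (simp add: algebra_simps)
  \<comment> \<open>The inequality 1 + x \<le> exp x makes the factors of successive steps add up in
    the exponent.\<close>
  also have "\<dots> \<le> exp (c * v) * (LINT \<omega>|M. Z \<omega>)"
    by (intro mult_right_mono exp_ge_add_one_self) (simp add: Z_def)
  also have "\<dots> \<le> exp (c * v) * (exp t * exp (c * (exp t - 1) * (\<Sum>j\<le>n. real (w j))))"
    using Suc unfolding Z_def by (intro mult_left_mono) auto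
  also have "\<dots> = exp t * exp (c * (exp t - 1) * (\<Sum>j\<le>Suc n. real (w j)))"
    by (simp add: v_def exp_add[symmetric] algebra_simps)
  finally show ?case .
qed

section \<open>Chernoff estimates with deterministic and with independent random weights\<close>

text \<open>Markov's inequality for the exponential of the weighted sum, combined with the moment
  bound. The weights enter only through the bound \<open>a * real k\<close> on their total, so the
  estimate is uniform over all such weights.\<close>

lemma markov_chain_tail_bound:
  fixes w :: "nat \<Rightarrow> nat"
  assumes "prob_space M" and mc: "binary_markov_chain M p X"
    and r: "r \<in> {0, 1}" and le: "\<And>q i. q \<in> {0, 1} \<Longrightarrow> p q r i \<le> c" and c: "0 \<le> c"
    and w: "\<And>j. j < k \<Longrightarrow> w j \<in> {0, 1}" and wa: "(\<Sum>j<k. real (w j)) \<le> a * real k"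
    and t: "0 \<le> t" and k: "1 \<le> k"
  shows "\<P>(\<omega> in M. b * real k < (\<Sum>j<k. real (w j) * of_bool (X j \<omega> = r)))
    \<le> exp t * exp (c * a * (exp t - 1) - t * b) ^ k"
proof -
  interpret prob_space M by fact
  have bp: "binary_process M X"
    using mc by (auto simp: binary_markov_chain_def)
  note [measurable] = binary_process_measurable[OF bp]
  \<comment> \<open>The moment bound sums over \<open>j \<le> n\<close>, hence the shift by
    one.\<close>
  obtain n where kn: "k = Suc n" using k by (cases k) auto
  define S where "S \<omega> = (\<Sum>j<k. real (w j) * of_bool (X j \<omega> = r))" for \<omega>
  have [measurable]: "S \<in> borel_measurable M" unfolding S_def by measurable
  have mgf: "(LINT \<omega>|M. exp (t * S \<omega>)) \<le> exp t * exp (c * (exp t - 1) * (\<Sum>j<k. real (w j)))"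
    using markov_chain_mgf_bound[OF assms(1) mc r le c _ t, of n w] w
    unfolding S_def kn lessThan_Suc_atMost by auto
  have int: "integrable M (\<lambda>\<omega>. exp (t * S \<omega>))"
  proof (rule integrable_const_bound[where B = "exp (t * (\<Sum>j<k. real (w j)))"])
    show "AE \<omega> in M. norm (exp (t * S \<omega>)) \<le> exp (t * (\<Sum>j<k. real (w j)))"
      using t unfolding S_def
      by (intro AE_I2) (simp del: sum_mult_of_bool_eq, intro mult_left_mono sum_mono, auto)
  qed measurable
  have "\<P>(\<omega> in M. b * real k < S \<omega>) \<le> \<P>(\<omega> in M. exp (t * (b * real k)) \<le> exp (t * S \<omega>))"
    using t by (intro finite_measure_mono) (auto intro!: mult_left_mono)
  also have "\<dots> \<le> (LINT \<omega>|M. exp (t * S \<omega>)) / exp (t * (b * real k))"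
    by (rule integral_Markov_inequality_measure[OF int, of "{}"]) auto
  also have "\<dots> \<le> exp t * exp (c * (exp t - 1) * (a * real k)) / exp (t * (b * real k))"
    using c t wa by (intro divide_right_mono order.trans[OF mgf] mult_left_mono) (auto intro!: mult_left_mono)
  also have "\<dots> = exp t * exp (c * a * (exp t - 1) - t * b) ^ k"
    by (simp add: exp_of_nat_mult[symmetric] exp_diff[symmetric] exp_add[symmetric] algebra_simps)
  finally show ?thesis by (simp add: S_def)
qed

text \<open>The expression vanishes at t = 0 and has derivative x - b < 0 there, so it is negative
  just to the right of 0. Such a t makes the Chernoff bound decay geometrically.\<close>

lemma ex_exp_rate_negative:
  fixes x b :: real
  assumes "x < b"
  shows "\<exists>t>0. x * (exp t - 1) - t * b < 0"
proof -
  have "((\<lambda>t. x * (exp t - 1) - t * b) has_real_derivative x - b) (at 0)"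
    by (auto intro!: derivative_eq_intros)
  from DERIV_neg_dec_right[OF this] assms obtain d where
    d: "d > 0" "\<And>h. 0 < h \<Longrightarrow> h < d \<Longrightarrow> x * (exp h - 1) - h * b < 0"
    by auto
  show ?thesis
    by (rule exI[of _ "d / 2"]) (use d d(2)[of "d / 2"] in auto)
qed

text \<open>
  Condition on the first \<open>k\<close> values \<open>w\<close> of \<open>Y\<close>: by independence the tail bound with
  deterministic weights \<open>w\<close> applies on each of these finitely many events.
\<close>

lemma indep_weighted_tail_bound:
  assumes "prob_space M" and mc: "binary_markov_chain M p X"
    and r: "r \<in> {0, 1}" and le: "\<And>q i. q \<in> {0, 1} \<Longrightarrow> p q r i \<le> c" and c: "0 \<le> c"
    and bpY: "binary_process M Y" and ind: "indep_binary_processes M X Y"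
    and t: "0 \<le> t" and k: "1 \<le> k"
  shows "\<P>(\<omega> in M. (\<Sum>j<k. real (Y j \<omega>)) \<le> a * real k \<and>
      b * real k < (\<Sum>j<k. real (Y j \<omega>) * of_bool (X j \<omega> = r)))
    \<le> exp t * exp (c * a * (exp t - 1) - t * b) ^ k"
proof -
  interpret prob_space M by fact
  have bpX: "binary_process M X"
    using mc by (auto simp: binary_markov_chain_def)
  note [measurable] = binary_process_measurable[OF bpX] binary_process_measurable[OF bpY]
  let ?N = "\<Pi>\<^sub>M i\<in>(UNIV :: nat set). count_space {0, 1::nat}"
  \<comment> \<open>\<open>W\<close> collects the admissible patterns for the first \<open>k\<close>
    values of \<open>Y\<close>. The event \<open>E w\<close> depends on \<open>Y\<close> alone and
    \<open>D w\<close> on \<open>X\<close> alone.\<close>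
  define W where "W = {w \<in> PiE {..<k} (\<lambda>_. {0, 1::nat}). (\<Sum>j<k. real (w j)) \<le> a * real k}"
  define E where "E w = {\<omega>\<in>space M. \<forall>j<k. Y j \<omega> = w j}" for w
  define D where "D w = {\<omega>\<in>space M. b * real k < (\<Sum>j<k. real (w j) * of_bool (X j \<omega> = r))}" for w
  let ?B = "exp t * exp (c * a * (exp t - 1) - t * b) ^ k"
  have finW: "finite W" unfolding W_def by (intro finite_Collect_conjI disjI1) (auto intro: finite_PiE)
  have meas: "E w \<in> events" "D w \<in> events" for w
    unfolding E_def D_def by measurable
  have disj: "disjoint_family_on E W"
  proof (unfold disjoint_family_on_def, intro ballI impI)
    fix v w assume *: "v \<in> W" "w \<in> W" "v \<noteq> w"
    have False if "\<omega> \<in> E v" "\<omega> \<in> E w" for \<omega>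
    proof -
      have "v = w"
        using * that by (intro PiE_ext[of v "{..<k}" "\<lambda>_. {0, 1}"]) (auto simp: W_def E_def)
      with * show False by simp
    qed
    then show "E v \<inter> E w = {}" by auto
  qed
  have prod: "prob (D w \<inter> E w) = prob (D w) * prob (E w)" for w
  proof -
    \<comment> \<open>Independence is that of whole sequences, so \<open>D w\<close> and
      \<open>E w\<close> are written as preimages of measurable sets in the sequence space
      \<open>?N\<close>.\<close>
    let ?A = "{x\<in>space ?N. b * real k < (\<Sum>j<k. real (w j) * of_bool (x j = r))}"
    let ?C = "{y\<in>space ?N. \<forall>j<k. y j = w j}"
    have comp: "(\<lambda>x. x j) \<in> measurable ?N (count_space UNIV)" for j
      by (rule measurable_compose[OF measurable_component_singleton[of j UNIV]]) auto
    note [measurable] = comp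
    have A: "?A \<in> sets ?N" and C: "?C \<in> sets ?N" by measurable
    have sp: "(\<lambda>i. X i \<omega>) \<in> space ?N" "(\<lambda>i. Y i \<omega>) \<in> space ?N" if "\<omega> \<in> space M" for \<omega>
      using binary_process_values[OF bpX that] binary_process_values[OF bpY that]
      by (simp_all add: space_PiM PiE_UNIV_domain)
    have "D w \<inter> E w = (\<lambda>\<omega>. (\<lambda>i. X i \<omega>, \<lambda>i. Y i \<omega>)) -` (?A \<times> ?C) \<inter> space M"
      "D w = (\<lambda>\<omega> i. X i \<omega>) -` ?A \<inter> space M" "E w = (\<lambda>\<omega> i. Y i \<omega>) -` ?C \<inter> space M"
      using sp by (auto simp: D_def E_def)
    then show ?thesis
      using indep_varD[OF ind[unfolded indep_binary_processes_def] A C] by simp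
  qed
  have Dle: "prob (D w) \<le> ?B" if "w \<in> W" for w
    unfolding D_def using that
    by (intro markov_chain_tail_bound[OF assms(1) mc r le c _ _ t k]) (auto simp: W_def)
  have "\<P>(\<omega> in M. (\<Sum>j<k. real (Y j \<omega>)) \<le> a * real k \<and>
      b * real k < (\<Sum>j<k. real (Y j \<omega>) * of_bool (X j \<omega> = r))) \<le> prob (\<Union>w\<in>W. D w \<inter> E w)"
  proof (intro finite_measure_mono subsetI)
    fix \<omega> assume *: "\<omega> \<in> {\<omega>\<in>space M. (\<Sum>j<k. real (Y j \<omega>)) \<le> a * real k \<and>
      b * real k < (\<Sum>j<k. real (Y j \<omega>) * of_bool (X j \<omega> = r))}"
    then have "(\<lambda>j\<in>{..<k}. Y j \<omega>) \<in> W"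
      using binary_process_values[OF bpY, of \<omega>] by (auto simp: W_def)
    moreover have "\<omega> \<in> D (\<lambda>j\<in>{..<k}. Y j \<omega>) \<inter> E (\<lambda>j\<in>{..<k}. Y j \<omega>)"
      using * by (auto simp: D_def E_def)
    ultimately show "\<omega> \<in> (\<Union>w\<in>W. D w \<inter> E w)" by blast
  qed (intro sets.finite_UN finW sets.Int meas)
  also have "\<dots> \<le> (\<Sum>w\<in>W. prob (D w \<inter> E w))"
    using finW meas by (intro finite_measure_subadditive_finite) auto
  also have "\<dots> \<le> (\<Sum>w\<in>W. ?B * prob (E w))"
    unfolding prod using Dle by (intro sum_mono mult_right_mono) auto
  \<comment> \<open>As the \<open>E w\<close> are disjoint, their probabilities sum to at most 1;
    the number of patterns does not enter the bound.\<close>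
  also have "\<dots> = ?B * prob (\<Union>w\<in>W. E w)"
    using finW disj meas by (subst finite_measure_finite_Union) (auto simp: sum_distrib_left)
  also have "\<dots> \<le> ?B * 1"
    by (intro mult_left_mono prob_le_1) auto
  finally show ?thesis by simp
qed

section \<open>Summability of the tail probabilities of the overall failures\<close>

theorem proposition2p4:
  fixes M :: "'a measure"
    and lR lM :: "nat \<Rightarrow> 'a \<Rightarrow> nat"
    and p :: "nat \<Rightarrow> nat \<Rightarrow> nat \<Rightarrow> real"
    and p1 p0 \<rho>M :: real
  assumes "prob_space M"
    and "binary_markov_chain M p lR"
    and "p1 \<in> {0<..<1}" and "p0 \<in> {0<..<1}"
    and "\<And>q i. q \<in> {0, 1} \<Longrightarrow> p q 1 i \<le> p1"
    and "\<And>q i. q \<in> {0, 1} \<Longrightarrow> p q 0 i \<le> p0"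
    and "binary_process M lM"
    and "\<rho>M \<in> {0..1}"
    and "(\<lambda>k. \<P>(\<omega> in M. real (total_failures lM k \<omega>) > \<rho>M * real k)) summable_on {1..}"
    and "indep_binary_processes M lR lM"
    and "p1 + p0 * \<rho>M < 1"
  shows "\<forall>\<rho> \<in> {p1 + p0 * \<rho>M<..<1}.
    (\<lambda>k. \<P>(\<omega> in M. real (total_failures (exchange_failure lR lM) k \<omega>) > \<rho> * real k))
      summable_on {1..}"
proof
  fix \<rho> assume \<rho>: "\<rho> \<in> {p1 + p0 * \<rho>M<..<1}"
  interpret prob_space M by fact
  note mc = assms(2) and bpM = assms(7)
  have bpR: "binary_process M lR"
    using mc by (auto simp: binary_markov_chain_def)
  note [measurable] = binary_process_measurable[OF bpR] binary_process_measurable[OF bpM]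
  \<comment> \<open>Half of the slack goes to each threshold, so both exceed their mean rates
    strictly and still add up to \<open>\<rho>\<close>.\<close>
  define \<delta> where "\<delta> = (\<rho> - (p1 + p0 * \<rho>M)) / 2"
  define b1 where "b1 = p1 + \<delta>"
  define b0 where "b0 = p0 * \<rho>M + \<delta>"
  have \<delta>: "\<delta> > 0" "b1 + b0 = \<rho>"
    using \<rho> by (auto simp: \<delta>_def b1_def b0_def field_simps)
  obtain t1 where t1: "t1 > 0" "p1 * (exp t1 - 1) - t1 * b1 < 0"
    using ex_exp_rate_negative[of p1 b1] \<delta> by (auto simp: b1_def)
  obtain t0 where t0: "t0 > 0" "p0 * \<rho>M * (exp t0 - 1) - t0 * b0 < 0"
    using ex_exp_rate_negative[of "p0 * \<rho>M" b0] \<delta> by (auto simp: b0_def)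
  let ?g1 = "\<lambda>k. exp t1 * exp (p1 * (exp t1 - 1) - t1 * b1) ^ k"
  let ?g0 = "\<lambda>k. exp t0 * exp (p0 * \<rho>M * (exp t0 - 1) - t0 * b0) ^ k"
  let ?m = "\<lambda>k. \<P>(\<omega> in M. real (total_failures lM k \<omega>) > \<rho>M * real k)"
  have geo: "(\<lambda>k. exp t * exp u ^ k) summable_on {1::nat..}" if "u < 0" for t u :: real
  proof -
    \<comment> \<open>Unconditional summability follows from absolute convergence of the geometric
      series, as \<open>exp u\<close> < 1.\<close>
    have "(\<lambda>k. exp t * exp u ^ k) summable_on UNIV"
      using that by (intro norm_summable_imp_summable_on)
        (auto simp: abs_mult intro!: summable_mult summable_geometric)
    then show ?thesis by (rule summable_on_subset_banach) auto
  qed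
  have dom: "\<P>(\<omega> in M. real (total_failures (exchange_failure lR lM) k \<omega>) > \<rho> * real k)
      \<le> ?g1 k + ?g0 k + ?m k" if k: "k \<in> {1..}" for k
  proof -
    let ?A = "{\<omega>\<in>space M. b1 * real k < (\<Sum>j<k. real 1 * of_bool (lR j \<omega> = 1))}"
    let ?B = "{\<omega>\<in>space M. (\<Sum>j<k. real (lM j \<omega>)) \<le> \<rho>M * real k \<and>
        b0 * real k < (\<Sum>j<k. real (lM j \<omega>) * of_bool (lR j \<omega> = 0))}"
    let ?C = "{\<omega>\<in>space M. real (total_failures lM k \<omega>) > \<rho>M * real k}"
    \<comment> \<open>Constant weights 1 with \<open>a = 1\<close>; the factor \<open>real 1\<close>
      in \<open>?A\<close> keeps the shape of the weighted sum.\<close>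
    have A: "prob ?A \<le> ?g1 k"
      using markov_chain_tail_bound[OF assms(1) mc, of 1 p1 k "\<lambda>_. 1" 1 t1 b1]
        assms(3,5) t1 k by auto
    have B: "prob ?B \<le> ?g0 k"
      using indep_weighted_tail_bound[OF assms(1) mc, of 0 p0 lM t0 k \<rho>M b0]
        assms(4,6,10) bpM t0 k by auto
    have meas: "?A \<in> events" "?B \<in> events" "?C \<in> events"
      unfolding total_failures_def by measurable
    have "prob {\<omega>\<in>space M. real (total_failures (exchange_failure lR lM) k \<omega>) > \<rho> * real k}
        \<le> prob (?A \<union> ?B \<union> ?C)"
    proof (intro finite_measure_mono subsetI)
      fix \<omega> assume *: "\<omega> \<in> {\<omega>\<in>space M. real (total_failures (exchange_failure lR lM) k \<omega>) > \<rho> * real k}"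
      \<comment> \<open>Both processes take values 0 and 1; attacks are counted only when the chain
        is in state 0, so no failure is counted twice.\<close>
      have "real (exchange_failure lR lM j \<omega>) =
          real 1 * of_bool (lR j \<omega> = 1) + real (lM j \<omega>) * of_bool (lR j \<omega> = 0)" for j
        using * binary_process_values[OF bpR, of \<omega> j] binary_process_values[OF bpM, of \<omega> j]
        by (auto simp: exchange_failure_def)
      then have "(b1 + b0) * real k < (\<Sum>j<k. real 1 * of_bool (lR j \<omega> = 1)) +
          (\<Sum>j<k. real (lM j \<omega>) * of_bool (lR j \<omega> = 0))"
        using * \<delta> by (simp add: total_failures_def sum.distrib)
      then have "b1 * real k < (\<Sum>j<k. real 1 * of_bool (lR j \<omega> = 1)) \<or>
          b0 * real k < (\<Sum>j<k. real (lM j \<omega>) * of_bool (lR j \<omega> = 0))"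
        unfolding distrib_right by linarith
      \<comment> \<open>In the second alternative the point lies in \<open>?B\<close> or in
        \<open>?C\<close>, according to whether \<open>lM\<close> has at most
        \<open>\<rho>M * real k\<close> ones.\<close>
      with * show "\<omega> \<in> ?A \<union> ?B \<union> ?C" by (auto simp: total_failures_def)
    qed (intro sets.Un meas)
    also have "\<dots> \<le> prob ?A + prob ?B + prob ?C"
      by (intro order.trans[OF measure_Un_le] add_mono order.refl sets.Un meas)
    finally show ?thesis using A B by linarith
  qed
  have "(\<lambda>k. ?g1 k + ?g0 k + ?m k) summable_on {1..}"
    using t1 t0 by (intro summable_on_add geo assms(9)) auto
  then show "(\<lambda>k. \<P>(\<omega> in M. real (total_failures (exchange_failure lR lM) k \<omega>) > \<rho> * real k))
      summable_on {1..}"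
    by (rule summable_on_comparison_test) (use dom in auto)
qed

end
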